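(* For every integer $n\ge 2$, $s(\mathbb{Z}/n\mathbb{Z})=s(n)$; that is, the ring invariant $s(R)$ evaluated at $R=\mathbb{Z}/n\mathbb{Z}$ equals the value at $n$ of the number-theoretic Smarandache function.
   Context: For a commutative ring $R$ with unit element, $$s(R):=\min\{m\in\mathbb{N} : \exists\, p\in R[x],\ \deg(p)<m,\ \forall x\in R:\ p(x)=x^m\}$$ if such an $m$ exists, and $s(R):=\infty$ otherwise. (Equivalently, $s(R)$ is the minimal degree of a polynomial in $R[x]$ with leading coefficient $1$ that vanishes at every element of $R$.) The number-theoretic Smarandache function is $s(n):=\min\{k\in\mathbb{N} : n\mid k!\}$. Here $\mathbb{N}=\{1,2,3,\dots\}$. *)

theory Defs
  imports
    "HOL-Library.Extended_Nat"
    "HOL-Algebra.UnivPoly"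
    "HOL-Number_Theory.Residues"
begin

(* The polynomial p of R[x] is an element of UP R, and p(x) is its evaluation in R itself,
   i.e. along the identity coefficient map. UnivPoly.deg assigns degree 0 to the zero
   polynomial; as m is at least 1, the zero polynomial satisfies "degree < m" either way. *)
definition ring_smarandache_witness :: "('a, 'b) ring_scheme \<Rightarrow> nat \<Rightarrow> bool" where
  "ring_smarandache_witness R m \<longleftrightarrow>
     m \<ge> 1 \<and>
     (\<exists>p \<in> carrier (UP R). deg R p < m \<and>
        (\<forall>x \<in> carrier R. eval R R id x p = x [^]\<^bsub>R\<^esub> m))"

(* Meant for commutative rings R with unit. *)
definition ring_smarandache :: "('a, 'b) ring_scheme \<Rightarrow> enat" where
  "ring_smarandache R =
     (if \<exists>m. ring_smarandache_witness R m
      then enat (LEAST m. ring_smarandache_witness R m)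
      else \<infinity>)"

(* Meant for n \<ge> 1; the minimum ranges over positive k, so the value at 1 is 1. *)
definition smarandache :: "nat \<Rightarrow> nat" where
  "smarandache n = (LEAST k. k \<ge> 1 \<and> n dvd fact k)"

end

theory Submission
  imports Defs "HOL-Computational_Algebra.Polynomial"
begin

text \<open>
  A ring witness of degree \<open>k\<close> for \<open>\<int>/n\<int>\<close> amounts to a monic polynomial of degree \<open>k\<close>
  whose values at all integers are divisible by \<open>n\<close>: subtract the low-degree polynomial from
  \<open>x\<^sup>k\<close> and lift coefficients to integers, or reduce them modulo \<open>n\<close> to go back
  (\<open>ring_smarandache_witness_iff_monic_vanishing\<close>).

  Over the integers such a polynomial exists if and only if \<open>n\<close> divides \<open>k!\<close>
  (\<open>monic_vanishing_mod_iff_dvd_fact\<close>). If \<open>n\<close> divides \<open>k!\<close>, the rising factorial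
  \<open>x (x + 1) \<cdots> (x + k - 1)\<close> works, being \<open>k!\<close> times a binomial coefficient. Conversely,
  forward differences preserve divisibility of all values by \<open>n\<close>, and the \<open>k\<close>-th difference of
  a monic polynomial of degree \<open>k\<close> is the constant \<open>k!\<close>.

  So the two minima in the theorem are taken over the same set of positive integers, which
  contains \<open>n\<close> and hence is not empty.
\<close>

lemma poly_forward_difference:
  fixes f :: "'a::comm_ring_1 poly"
  assumes "degree f \<le> Suc m"
  shows "\<exists>g. degree g \<le> m \<and> Polynomial.coeff g m = of_nat (Suc m) * Polynomial.coeff f (Suc m)
             \<and> (\<forall>x. poly g x = poly f (x + 1) - poly f x)"
  using assms
proof (induction m arbitrary: f)
  case 0
  obtain a q where f: "f = pCons a q" by (cases f)
  with 0 have "degree q = 0" by (auto split: if_splits)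
  then obtain b where "q = [:b:]" by (rule degree_eq_zeroE)
  with f show ?case
    by (intro exI[of _ "[:b:]"]) (auto simp: algebra_simps)
next
  case (Suc m)
  obtain a q where f: "f = pCons a q" by (cases f)
  with Suc.prems have q: "degree q \<le> Suc m" by (auto split: if_splits)
  from Suc.IH[OF q] obtain h where h: "degree h \<le> m"
    "Polynomial.coeff h m = of_nat (Suc m) * Polynomial.coeff q (Suc m)"
    "\<And>x. poly h x = poly q (x + 1) - poly q x" by blast
  \<comment> \<open>With \<open>f(x) = a + x q(x)\<close>, the difference \<open>f(x + 1) - f(x)\<close> is
    \<open>q(x + 1) + x h(x) = q(x) + h(x) + x h(x)\<close>.\<close>
  define g where "g = q + h + pCons 0 h"
  have "degree g \<le> Suc m"
    unfolding g_def using q h(1)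
    by (intro degree_add_le order.trans[OF degree_pCons_le]) auto
  moreover have "Polynomial.coeff h (Suc m) = 0"
    using h(1) by (intro coeff_eq_0) auto
  then have "Polynomial.coeff g (Suc m) = of_nat (Suc (Suc m)) * Polynomial.coeff f (Suc (Suc m))"
    by (simp add: g_def f h(2) algebra_simps)
  moreover have "poly g x = poly f (x + 1) - poly f x" for x
    by (simp add: g_def f h(3) algebra_simps)
  ultimately show ?case by blast
qed

text \<open>
  Each forward difference lowers the degree bound from \<open>m\<close> to \<open>m - 1\<close>, multiplies the top
  coefficient by \<open>m\<close>, and keeps all values divisible by \<open>d\<close>. After \<open>m\<close> steps the constant
  \<open>m!\<close> times the original top coefficient remains.
\<close>

lemma dvd_fact_mult_coeff_if_dvd_values:
  fixes f :: "'a::{comm_ring_1, semiring_char_0} poly"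
  assumes "degree f \<le> m" and "\<And>x. d dvd poly f x"
  shows "d dvd fact m * Polynomial.coeff f m"
  using assms
proof (induction m arbitrary: f)
  case 0
  then obtain a where "f = [:a:]" by (auto elim: degree_eq_zeroE)
  with 0 show ?case by simp
next
  case (Suc m)
  from poly_forward_difference[OF Suc.prems(1)] obtain g where g: "degree g \<le> m"
    "Polynomial.coeff g m = of_nat (Suc m) * Polynomial.coeff f (Suc m)"
    "\<And>x. poly g x = poly f (x + 1) - poly f x" by blast
  have "d dvd fact m * Polynomial.coeff g m"
    using Suc.prems(2) by (intro Suc.IH g(1)) (simp add: g(3))
  then show ?case by (simp add: g(2) algebra_simps)
qed

lemma monic_int_poly_fact_dvd_values:
  "\<exists>q :: int poly. degree q = m \<and> lead_coeff q = 1 \<and> (\<forall>x. fact m dvd poly q x)"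
proof -
  define q :: "int poly" where "q = (\<Prod>i = 0..<m. [:int i, 1:])"
  have "degree q = m" unfolding q_def by (subst degree_prod_eq_sum_degree) auto
  moreover have "lead_coeff q = 1" unfolding q_def lead_coeff_prod by simp
  moreover have "poly q x = pochhammer x m" for x
    by (simp add: q_def poly_prod pochhammer_prod add.commute)
  ultimately show ?thesis by (metis fact_dvd_pochhammer)
qed

lemma monic_vanishing_mod_iff_dvd_fact:
  fixes d :: int
  shows "(\<exists>q :: int poly. degree q = m \<and> lead_coeff q = 1 \<and> (\<forall>x. d dvd poly q x)) \<longleftrightarrow> d dvd fact m"
proof
  assume "\<exists>q :: int poly. degree q = m \<and> lead_coeff q = 1 \<and> (\<forall>x. d dvd poly q x)"
  then show "d dvd fact m"
    using dvd_fact_mult_coeff_if_dvd_values[of _ m d] by fastforce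
next
  assume "d dvd fact m"
  then show "\<exists>q :: int poly. degree q = m \<and> lead_coeff q = 1 \<and> (\<forall>x. d dvd poly q x)"
    using monic_int_poly_fact_dvd_values[of m] dvd_trans by blast
qed

lemma poly_mod_arg: "poly q (x mod d) mod d = poly q x mod (d :: int)"
proof (induction q)
  case (pCons a q)
  have "[x mod d * poly q (x mod d) = x * poly q x] (mod d)"
    using pCons by (intro cong_mult) (auto simp: cong_def)
  then show ?case by (auto simp: cong_def intro: mod_add_cong)
qed simp

context residues
begin

text \<open>
  Replacing the degree by any larger bound \<open>k\<close> lets the degree of \<open>p\<close>, which may drop below
  \<open>k - 1\<close>, disappear from the comparison with integer polynomials.
\<close>

lemma eval_UP_eq_sum_mod:
  assumes p: "p \<in> carrier (UP R)" "deg R p < k" and x: "x \<in> carrier R"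
  shows "eval R R id x p = (\<Sum>i<k. up_ring.coeff (UP R) p i * x ^ i) mod m"
proof -
  interpret UP_ring R "UP R" by unfold_locales
  let ?c = "up_ring.coeff (UP R) p"
  have pow: "x [^] i = x ^ i mod m" for i :: nat
    using pow_cong[of x i] x by (simp add: res_carrier_eq)
  have "eval R R id x p = (\<Oplus>i\<in>{..deg R p}. (?c i * x ^ i) mod m)"
    using p(1) by (simp add: eval_on_carrier pow res_mult_eq mod_mult_right_eq)
  also have "\<dots> = (\<Sum>i\<in>{..deg R p}. ?c i * x ^ i) mod m"
    by (rule sum_cong) simp
  also have "(\<Sum>i\<in>{..deg R p}. ?c i * x ^ i) = (\<Sum>i<k. ?c i * x ^ i)"
    using p by (intro sum.mono_neutral_left) (auto simp: deg_aboveD res_zero_eq)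
  finally show ?thesis .
qed

text \<open>
  Polynomials over the residue ring have integer coefficients in \<open>{0..m - 1}\<close>, so they are
  already integer polynomials; conversely, reducing coefficients modulo \<open>m\<close> does not change
  values modulo \<open>m\<close>. Vanishing on the representatives \<open>{0..m - 1}\<close> and on all integers is the
  same by periodicity, \<open>poly_mod_arg\<close>.
\<close>

lemma ring_smarandache_witness_iff_monic_vanishing:
  "ring_smarandache_witness R k \<longleftrightarrow>
     k \<ge> 1 \<and> (\<exists>q :: int poly. degree q = k \<and> lead_coeff q = 1 \<and> (\<forall>x. m dvd poly q x))"
proof (intro iffI conjI)
  assume w: "ring_smarandache_witness R k"
  then show "k \<ge> 1" by (simp add: ring_smarandache_witness_def)
  from w obtain p where p: "p \<in> carrier (UP R)" "deg R p < k"
    and ev: "\<And>x. x \<in> carrier R \<Longrightarrow> eval R R id x p = x [^] k"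
    by (auto simp: ring_smarandache_witness_def)
  define r where "r = (\<Sum>i<k. Polynomial.monom (up_ring.coeff (UP R) p i) i)"
  define q where "q = Polynomial.monom 1 k - r"
  have r_coeff: "Polynomial.coeff r i = 0" if "i \<ge> k" for i
    using that by (simp add: r_def coeff_sum)
  have "Polynomial.coeff q i = 0" if "i > k" for i
    using that by (simp add: q_def r_coeff)
  moreover have lead: "Polynomial.coeff q k = 1" by (simp add: q_def r_coeff)
  ultimately have "degree q = k"
    by (intro order.antisym degree_le le_degree) auto
  moreover have "m dvd poly q x" for x
  proof -
    define y where "y = x mod m"
    have y: "y \<in> carrier R" by (simp add: y_def)
    have "poly r y mod m = y ^ k mod m"
      using eval_UP_eq_sum_mod[OF p y] ev[OF y] pow_cong[of x k]
      by (simp add: r_def poly_sum poly_monom y_def power_mod)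
    then have "m dvd poly q y"
      by (simp add: q_def poly_monom mod_eq_dvd_iff dvd_diff_commute)
    then show ?thesis
      using poly_mod_arg[of q x m] by (simp add: y_def dvd_eq_mod_eq_0)
  qed
  ultimately show "\<exists>q :: int poly. degree q = k \<and> lead_coeff q = 1 \<and> (\<forall>x. m dvd poly q x)"
    using lead by blast
next
  interpret UP_ring R "UP R" by unfold_locales
  assume "k \<ge> 1 \<and> (\<exists>q :: int poly. degree q = k \<and> lead_coeff q = 1 \<and> (\<forall>x. m dvd poly q x))"
  then obtain q :: "int poly" where k: "k \<ge> 1" and q: "degree q = k" "lead_coeff q = 1"
    and van: "\<And>x. m dvd poly q x" by blast
  define r where "r = Polynomial.monom 1 k - q"
  have r_coeff: "Polynomial.coeff r i = 0" if "i \<ge> k" for i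
    using that q by (cases "i = k") (auto simp: r_def coeff_eq_0)
  define p where "p = (\<lambda>i. Polynomial.coeff r i mod m)"
  have "p \<in> up R"
    by (intro mem_upI exI[of _ k] bound.intro) (auto simp: p_def r_coeff res_zero_eq)
  then have p: "p \<in> carrier (UP R)" and coeff_p: "up_ring.coeff (UP R) p = p"
    by (auto simp: UP_def)
  have "p i = 0" if "i > k - 1" for i
    using that by (simp add: p_def r_coeff)
  then have "deg R p \<le> k - 1"
    by (intro deg_aboveI p) (simp add: coeff_p res_zero_eq)
  with k have deg: "deg R p < k" by simp
  have "eval R R id x p = x [^] k" if x: "x \<in> carrier R" for x
  proof -
    have "degree r < k" using k r_coeff by (intro degree_lessI) auto
    then have "poly r x = (\<Sum>i<k. Polynomial.coeff r i * x ^ i)"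
      unfolding poly_altdef by (intro sum.mono_neutral_left) (auto simp: coeff_eq_0)
    moreover have "[(\<Sum>i<k. p i * x ^ i) = (\<Sum>i<k. Polynomial.coeff r i * x ^ i)] (mod m)"
      by (intro cong_sum cong_mult) (auto simp: p_def cong_def)
    ultimately have "eval R R id x p = poly r x mod m"
      using eval_UP_eq_sum_mod[OF p deg x] by (simp add: coeff_p cong_def)
    also have "\<dots> = x ^ k mod m"
      using van[of x] by (simp add: r_def poly_monom mod_eq_dvd_iff)
    also have "\<dots> = x [^] k"
      using pow_cong[of x k] x by (simp add: res_carrier_eq)
    finally show ?thesis .
  qed
  with k p deg show "ring_smarandache_witness R k"
    unfolding ring_smarandache_witness_def by blast
qed

end

theorem theorem2:
  fixes n :: nat
  assumes "n \<ge> 2"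
  shows "ring_smarandache (residue_ring (int n)) = enat (smarandache n)"
proof -
  interpret residues "int n" "residue_ring (int n)"
    by unfold_locales (use assms in auto)
  have "int n dvd fact k \<longleftrightarrow> n dvd fact k" for k
    by (metis int_dvd_int_iff of_nat_fact)
  then have "ring_smarandache_witness (residue_ring (int n)) = (\<lambda>k. k \<ge> 1 \<and> n dvd fact k)"
    by (simp add: fun_eq_iff ring_smarandache_witness_iff_monic_vanishing monic_vanishing_mod_iff_dvd_fact)
  moreover have "n \<ge> 1 \<and> n dvd fact n" using assms by (simp add: dvd_fact)
  ultimately show ?thesis
    unfolding ring_smarandache_def smarandache_def by auto
qed

end
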